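(* Let $f=h+\overline{g}\in\mathcal{H_R}$. Then the pre-Schwarzian norm of $f$ satisfies $\|P_f\|\le 3$. The estimate is sharp, i.e. the constant $3$ cannot be replaced by any smaller constant valid for all $f\in\mathcal{H_R}$.
   Context: Let $\mathbb{D}=\{z\in\mathbb{C}:|z|<1\}$. $\mathcal{A}$ is the class of analytic functions $h$ in $\mathbb{D}$ with $h(0)=0$, $h'(0)=1$. $\mathcal{H}$ is the class of all sense-preserving harmonic functions $f=h+\overline{g}$ in $\mathbb{D}$, with $h,g$ analytic in $\mathbb{D}$ of the form $h(z)=z+\sum_{n=2}^\infty a_nz^n$, $g(z)=\sum_{n=1}^\infty b_nz^n$; sense-preserving means that the Jacobian $J_f=|h'|^2-|g'|^2$ is positive in $\mathbb{D}$. The dilatation of $f$ is $\omega=g'/h'$ (analytic with $|\omega|<1$ in $\mathbb{D}$). $\mathcal{R}$ is the class of functions $h\in\mathcal{A}$ such that, for some $m\in\mathbb{N}=\{1,2,3,\dots\}$, $h'(z)=\frac{m}{m-z^m}$ for all $z\in\mathbb{D}$. $\mathcal{H_R}$ is the class of all $f=h+\overline{g}\in\mathcal{H}$ with $h\in\mathcal{R}$. The pre-Schwarzian derivative of $f=h+\overline{g}$ is $P_f=(\log J_f)_z=\frac{h''}{h'}-\frac{\overline{\omega}\,\omega'}{1-|\omega|^2}$, and the pre-Schwarzian norm is $\|P_f\|=\sup_{z\in\mathbb{D}}(1-|z|^2)|P_f(z)|$. *)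

theory Defs
  imports "HOL-Complex_Analysis.Complex_Analysis"
begin

definition unit_disc :: "complex set" where
  "unit_disc = ball 0 1"

text \<open>
  Wirtinger derivatives \<open>F\<^sub>z = (F\<^sub>x - \<i> F\<^sub>y) / 2\<close> and \<open>(F\<^sub>x + \<i> F\<^sub>y) / 2\<close>, where the partial
  derivatives are the values of the real Frechet derivative at \<open>1\<close> and \<open>\<i>\<close>.
\<close>

definition wirtinger :: "(complex \<Rightarrow> complex) \<Rightarrow> complex \<Rightarrow> complex" where
  "wirtinger F z = (frechet_derivative F (at z) 1 - \<i> * frechet_derivative F (at z) \<i>) / 2"

definition wirtinger_bar :: "(complex \<Rightarrow> complex) \<Rightarrow> complex \<Rightarrow> complex" where
  "wirtinger_bar F z = (frechet_derivative F (at z) 1 + \<i> * frechet_derivative F (at z) \<i>) / 2"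

text \<open>
  For \<open>f = h + cnj g\<close> this is \<open>(norm h')\<^sup>2 - (norm g')\<^sup>2\<close>, see \<open>jacobian_det_eq\<close> below.
\<close>

definition jacobian_det :: "(complex \<Rightarrow> complex) \<Rightarrow> complex \<Rightarrow> real" where
  "jacobian_det f z = (norm (wirtinger f z))\<^sup>2 - (norm (wirtinger_bar f z))\<^sup>2"

definition class_A :: "(complex \<Rightarrow> complex) set" where
  "class_A = {h. h holomorphic_on unit_disc \<and> h 0 = 0 \<and> deriv h 0 = 1}"

text \<open>
  The canonical representation \<open>f = h + cnj g\<close>; the normalisations say exactly that the power
  series at \<open>0\<close> are \<open>h(z) = z + a\<^sub>2 z\<^sup>2 + ...\<close> and \<open>g(z) = b\<^sub>1 z + b\<^sub>2 z\<^sup>2 + ...\<close>.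
\<close>

definition harmonic_rep ::
    "(complex \<Rightarrow> complex) \<Rightarrow> (complex \<Rightarrow> complex) \<Rightarrow> (complex \<Rightarrow> complex) \<Rightarrow> bool" where
  "harmonic_rep f h g \<longleftrightarrow> h \<in> class_A \<and> g holomorphic_on unit_disc \<and> g 0 = 0 \<and>
     (\<forall>z\<in>unit_disc. f z = h z + cnj (g z))"

definition class_H :: "(complex \<Rightarrow> complex) set" where
  "class_H = {f. (\<exists>h g. harmonic_rep f h g) \<and> (\<forall>z\<in>unit_disc. jacobian_det f z > 0)}"

definition class_R :: "(complex \<Rightarrow> complex) set" where
  "class_R = {h \<in> class_A. \<exists>m::nat. m \<ge> 1 \<and>
     (\<forall>z\<in>unit_disc. deriv h z = of_nat m / (of_nat m - z ^ m))}"

definition class_HR :: "(complex \<Rightarrow> complex) set" where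
  "class_HR = {f \<in> class_H. \<exists>h g. harmonic_rep f h g \<and> h \<in> class_R}"

text \<open>
  \<open>P\<^sub>f = (log J\<^sub>f)\<^sub>z\<close>; the closed form in terms of \<open>h\<close> and the dilatation is \<open>pre_schwarzian_eq\<close> below.
\<close>

definition pre_schwarzian :: "(complex \<Rightarrow> complex) \<Rightarrow> complex \<Rightarrow> complex" where
  "pre_schwarzian f z = wirtinger (\<lambda>w. complex_of_real (ln (jacobian_det f w))) z"

text \<open>
  The supremum is taken in the extended reals, so that it is also meaningful (namely \<open>\<infinity>\<close>) when
  the set of values is unbounded.
\<close>

definition pre_schwarzian_norm :: "(complex \<Rightarrow> complex) \<Rightarrow> ereal" where
  "pre_schwarzian_norm f =
     (SUP z\<in>unit_disc. ereal ((1 - (norm z)\<^sup>2) * norm (pre_schwarzian f z)))"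

definition dilatation ::
    "(complex \<Rightarrow> complex) \<Rightarrow> (complex \<Rightarrow> complex) \<Rightarrow> complex \<Rightarrow> complex" where
  "dilatation h g z = deriv g z / deriv h z"

lemma wirtinger_eqI:
  assumes "(F has_derivative D) (at z)"
  shows "wirtinger F z = (D 1 - \<i> * D \<i>) / 2" "wirtinger_bar F z = (D 1 + \<i> * D \<i>) / 2"
  using frechet_derivative_at[OF assms] by (simp_all add: wirtinger_def wirtinger_bar_def)

lemma harmonic_rep_has_derivative:
  assumes "harmonic_rep f h g" "z \<in> unit_disc"
  shows "(f has_derivative (\<lambda>v. deriv h z * v + cnj (deriv g z * v))) (at z)"
proof -
  have h: "h holomorphic_on ball 0 1" and g: "g holomorphic_on ball 0 1" and z: "z \<in> ball 0 1"
    and eq: "\<And>w. w \<in> ball 0 1 \<Longrightarrow> f w = h w + cnj (g w)"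
    using assms by (auto simp: harmonic_rep_def class_A_def unit_disc_def)
  have "(h has_derivative (\<lambda>v. deriv h z * v)) (at z)"
    using holomorphic_derivI[OF h open_ball z, THEN has_field_derivative_imp_has_derivative] .
  moreover have "(g has_derivative (\<lambda>v. deriv g z * v)) (at z)"
    using holomorphic_derivI[OF g open_ball z, THEN has_field_derivative_imp_has_derivative] .
  then have "((\<lambda>w. cnj (g w)) has_derivative (\<lambda>v. cnj (deriv g z * v))) (at z)"
    by (rule has_derivative_cnj)
  ultimately have "((\<lambda>w. h w + cnj (g w)) has_derivative
      (\<lambda>v. deriv h z * v + cnj (deriv g z * v))) (at z)"
    by (rule has_derivative_add)
  then show ?thesis
    by (rule has_derivative_transform_within_open[OF _ open_ball z]) (simp add: eq)
qed

lemma wirtinger_harmonic: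
  assumes "harmonic_rep f h g" "z \<in> unit_disc"
  shows "wirtinger f z = deriv h z" "wirtinger_bar f z = cnj (deriv g z)"
  using wirtinger_eqI[OF harmonic_rep_has_derivative[OF assms]]
  by (simp_all add: algebra_simps)

lemma jacobian_det_eq:
  assumes "harmonic_rep f h g" "z \<in> unit_disc"
  shows "jacobian_det f z = (norm (deriv h z))\<^sup>2 - (norm (deriv g z))\<^sup>2"
  using wirtinger_harmonic[OF assms] by (simp add: jacobian_det_def)

lemma has_derivative_norm_square:
  assumes "(F has_field_derivative D) (at z)"
  shows "((\<lambda>w. (norm (F w :: complex))\<^sup>2) has_derivative (\<lambda>v. 2 * Re (D * v * cnj (F z)))) (at z)"
proof -
  have "(F has_derivative (\<lambda>v. D * v)) (at z)"
    using assms by (rule has_field_derivative_imp_has_derivative)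
  then have "((\<lambda>w. F w \<bullet> F w) has_derivative (\<lambda>v. F z \<bullet> (D * v) + (D * v) \<bullet> F z)) (at z)"
    using has_derivative_inner by blast
  then show ?thesis
    by (simp add: dot_square_norm inner_complex_def algebra_simps)
qed

lemma pre_schwarzian_eq:
  assumes rep: "harmonic_rep f h g" and pos: "\<forall>z\<in>unit_disc. jacobian_det f z > 0"
    and z: "z \<in> unit_disc"
  shows "pre_schwarzian f z = deriv (deriv h) z / deriv h z -
    cnj (dilatation h g z) * deriv (dilatation h g) z /
      complex_of_real (1 - (norm (dilatation h g z))\<^sup>2)"
proof -
  have h: "h holomorphic_on ball 0 1" and g: "g holomorphic_on ball 0 1" and z': "z \<in> ball 0 1"
    using rep z by (auto simp: harmonic_rep_def class_A_def unit_disc_def)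
  define a b c d where "a = deriv h z" "b = deriv g z" "c = deriv (deriv h) z" "d = deriv (deriv g) z"
  note abcd = this
  have dh: "(deriv h has_field_derivative c) (at z)" and dg: "(deriv g has_field_derivative d) (at z)"
    using holomorphic_derivI[OF holomorphic_deriv[OF h open_ball] open_ball z']
      holomorphic_derivI[OF holomorphic_deriv[OF g open_ball] open_ball z'] by (simp_all add: abcd)
  define J where "J = jacobian_det f z"
  have J: "J = (norm a)\<^sup>2 - (norm b)\<^sup>2" and J0: "J > 0"
    using jacobian_det_eq[OF rep z] pos z by (auto simp: J_def abcd)
  have a0: "a \<noteq> 0" using J J0 by auto
  define E where "E = c * cnj a - d * cnj b"
  have "((\<lambda>w. (norm (deriv h w))\<^sup>2 - (norm (deriv g w))\<^sup>2) has_derivative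
      (\<lambda>v. 2 * Re (c * v * cnj (deriv h z)) - 2 * Re (d * v * cnj (deriv g z)))) (at z)"
    by (intro has_derivative_diff has_derivative_norm_square dh dg)
  moreover have "(\<lambda>v. 2 * Re (c * v * cnj (deriv h z)) - 2 * Re (d * v * cnj (deriv g z)))
      = (\<lambda>v. 2 * Re (E * v))"
    by (rule ext) (simp add: E_def abcd algebra_simps)
  ultimately have "((\<lambda>w. (norm (deriv h w))\<^sup>2 - (norm (deriv g w))\<^sup>2) has_derivative
      (\<lambda>v. 2 * Re (E * v))) (at z)"
    by metis
  then have "(jacobian_det f has_derivative (\<lambda>v. 2 * Re (E * v))) (at z)"
    by (rule has_derivative_transform_within_open[OF _ open_ball z'])
      (use jacobian_det_eq[OF rep] in \<open>simp add: unit_disc_def\<close>)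
  then have "((\<lambda>w. ln (jacobian_det f w)) has_derivative (\<lambda>v. 2 * Re (E * v) * inverse J)) (at z)"
    using has_derivative_ln[of "jacobian_det f"] J0 by (simp add: J_def divide_inverse)
  then have "((\<lambda>w. complex_of_real (ln (jacobian_det f w))) has_derivative
      (\<lambda>v. complex_of_real (2 * Re (E * v) * inverse J))) (at z)"
    by (rule has_derivative_of_real)
  from wirtinger_eqI(1)[OF this]
  have "pre_schwarzian f z = E / of_real J"
    unfolding pre_schwarzian_def using J0
    by (simp add: complex_eq_iff Re_divide Im_divide field_simps power2_eq_square)
  also have "of_real J = a * cnj a - b * cnj b"
    unfolding J of_real_diff complex_norm_square ..
  finally have P: "pre_schwarzian f z = E / (a * cnj a - b * cnj b)" .
  have J0': "a * cnj a - b * cnj b \<noteq> 0"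
    using J0 J by (metis complex_norm_square less_irrefl of_real_0 of_real_diff of_real_eq_iff)
  have "((\<lambda>w. deriv g w / deriv h w) has_field_derivative (d * a - b * c) / (a * a)) (at z)"
    using DERIV_divide[OF dg dh] a0 by (simp add: abcd)
  moreover have "(\<lambda>w. deriv g w / deriv h w) = dilatation h g"
    by (auto simp: dilatation_def)
  ultimately have D: "deriv (dilatation h g) z = (d * a - b * c) / (a * a)"
    by (simp add: DERIV_imp_deriv)
  have dil: "dilatation h g z = b / a" by (simp add: dilatation_def abcd)
  have "c / a - cnj (b / a) * ((d * a - b * c) / (a * a)) / (1 - (b / a) * cnj (b / a))
      = E / (a * cnj a - b * cnj b)"
  proof -
    have *: "1 - (b / a) * cnj (b / a) = (a * cnj a - b * cnj b) / (a * cnj a)"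
      using a0 by (simp add: field_simps)
    show ?thesis unfolding * E_def using a0 J0' 
      by (simp add: divide_simps) (simp add: algebra_simps)
  qed
  moreover have "complex_of_real (1 - (norm (b / a))\<^sup>2) = 1 - (b / a) * cnj (b / a)"
    unfolding of_real_diff complex_norm_square by simp
  ultimately show ?thesis
    unfolding P D dil using abcd(1,3) by (simp del: of_real_diff)
qed

end

(*
  Both terms of the pre-Schwarzian derivative are estimated separately. For h' = m / (m - z^m) one
  has h'' / h' = m z^(m-1) / (m - z^m), and (1 - |z|^2) |h'' / h'| is at most 2; the Schwarz-Pick
  inequality bounds the remaining term by |\<omega>| < 1. For sharpness take m = 1 and let \<omega> be the
  disc automorphism with real coefficients, decreasing on the real axis, that maps r to r: at the
  point r, both terms are positive and Schwarz-Pick is an equality, so the norm is at least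
  (1 + r) + r, and r can be taken arbitrarily close to 1.
*)
theory Submission
  imports Defs
begin

section \<open>The Schwarz-Pick inequality for derivatives\<close>

lemma one_minus_cnj_mult_nonzero:
  assumes "norm w < 1" "norm z < 1"
  shows "1 - cnj w * z \<noteq> 0"
proof -
  have "norm (cnj w * z) < 1"
    using norm_mult_less[of "cnj w" 1 z 1] assms by simp
  then show ?thesis by auto
qed

text \<open>The first argument \<open>0\<close> is the rotation angle, so the function is (z - w) /
  (1 - cnj w * z). The formula is applied at three points: at \<open>0\<close> and at the zero
  \<open>w\<close> for Schwarz-Pick, and at a real point for sharpness.\<close>

lemma Moebius_function_has_field_derivative:
  assumes "norm w < 1" "norm z < 1"
  shows "(Moebius_function 0 w has_field_derivative
    of_real (1 - (norm w)\<^sup>2) / (1 - cnj w * z)\<^sup>2) (at z)"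
proof -
  have "((\<lambda>z. (z - w) / (1 - cnj w * z)) has_field_derivative
      (1 * (1 - cnj w * z) - (z - w) * (- cnj w)) / ((1 - cnj w * z) * (1 - cnj w * z))) (at z)"
    using one_minus_cnj_mult_nonzero[OF assms] by (auto intro!: derivative_eq_intros)
  moreover have "1 * (1 - cnj w * z) - (z - w) * (- cnj w) = of_real (1 - (norm w)\<^sup>2)"
    unfolding of_real_diff complex_norm_square by (simp add: algebra_simps)
  moreover have "(\<lambda>z. (z - w) / (1 - cnj w * z)) = Moebius_function 0 w"
    by (simp add: fun_eq_iff Moebius_function_simple)
  ultimately show ?thesis unfolding power2_eq_square[of "1 - cnj w * z"] by metis
qed

text \<open>Composing \<open>f\<close> with disc automorphisms that send 0 to \<open>z\<close> and
  \<open>f z\<close> to 0 gives a self-map \<open>F\<close> of the disc fixing 0. The Schwarz lemma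
  bounds its derivative there by 1, and the chain rule turns this into the claim.\<close>

theorem Schwarz_Pick_deriv:
  assumes hol: "f holomorphic_on ball 0 1"
    and less1: "\<And>z. norm z < 1 \<Longrightarrow> norm (f z) < 1"
    and z: "norm z < 1"
  shows "(1 - (norm z)\<^sup>2) * norm (deriv f z) \<le> 1 - (norm (f z))\<^sup>2"
proof -
  define F where "F = Moebius_function 0 (f z) \<circ> f \<circ> Moebius_function 0 (- z)"
  have fz: "norm (f z) < 1" using less1 z .
  have Mz: "norm (- z) < 1" using z by simp
  have M0: "Moebius_function 0 (- z) 0 = z" by (simp add: Moebius_function_simple)
  have "F holomorphic_on ball 0 1"
    unfolding F_def comp_assoc
  proof (intro holomorphic_on_compose_gen)
    show "Moebius_function 0 (- z) ` ball 0 1 \<subseteq> ball 0 1"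
      using Moebius_function_norm_lt_1[OF Mz] by auto
    then show "(f \<circ> Moebius_function 0 (- z)) ` ball 0 1 \<subseteq> ball 0 1"
      using less1 by fastforce
  qed (intro Moebius_function_holomorphic Mz fz hol)+
  moreover have "F 0 = 0" by (simp add: F_def M0 Moebius_function_eq_zero)
  moreover have "norm (F x) < 1" if "norm x < 1" for x
    unfolding F_def comp_apply
    using Moebius_function_norm_lt_1[OF fz less1[OF Moebius_function_norm_lt_1[OF Mz that]]] .
  ultimately have le1: "norm (deriv F 0) \<le> 1"
    using Schwarz_Lemma(2)[of F 0] by simp
  have d1: "(Moebius_function 0 (- z) has_field_derivative of_real (1 - (norm z)\<^sup>2)) (at 0)"
    using Moebius_function_has_field_derivative[OF Mz, of 0] by simp
  have d2: "(f has_field_derivative deriv f z) (at (Moebius_function 0 (- z) 0))"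
    unfolding M0 using holomorphic_derivI[OF hol open_ball] z by simp
  have pos: "1 - (norm (f z))\<^sup>2 > 0" "1 - (norm z)\<^sup>2 > 0"
    using fz z by (simp_all add: abs_square_less_1)
  \<comment> \<open>The outer automorphism is differentiated at its own zero, where numerator and
    denominator of the derivative are q and q^2 with q = 1 - |f z|^2, which leaves 1/q.\<close>
  have "1 - cnj (f z) * f z = of_real (1 - (norm (f z))\<^sup>2)"
    unfolding of_real_diff complex_norm_square by simp
  moreover have "w / w\<^sup>2 = inverse w" for w :: complex
    by (cases "w = 0") (simp_all add: power2_eq_square field_simps)
  ultimately have "of_real (1 - (norm (f z))\<^sup>2) / (1 - cnj (f z) * f z)\<^sup>2
      = inverse (complex_of_real (1 - (norm (f z))\<^sup>2))"
    by (simp only:)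
  then have "(Moebius_function 0 (f z) has_field_derivative
      inverse (of_real (1 - (norm (f z))\<^sup>2))) (at (f z))"
    using Moebius_function_has_field_derivative[OF fz fz] by (simp only:)
  then have d3: "(Moebius_function 0 (f z) has_field_derivative
      inverse (of_real (1 - (norm (f z))\<^sup>2))) (at ((f \<circ> Moebius_function 0 (- z)) 0))"
    by (simp add: M0)
  have "(F has_field_derivative
      inverse (of_real (1 - (norm (f z))\<^sup>2)) * (deriv f z * of_real (1 - (norm z)\<^sup>2))) (at 0)"
    unfolding F_def comp_assoc by (rule DERIV_chain[OF d3 DERIV_chain[OF d2 d1]])
  then have "deriv F 0 =
      inverse (of_real (1 - (norm (f z))\<^sup>2)) * (deriv f z * of_real (1 - (norm z)\<^sup>2))"
    by (rule DERIV_imp_deriv)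
  then have "norm (deriv F 0) =
      (1 - (norm z)\<^sup>2) * norm (deriv f z) / (1 - (norm (f z))\<^sup>2)"
    using pos by (simp add: norm_mult norm_inverse divide_inverse del: of_real_diff)
  then show ?thesis using le1 pos(1) by (simp only: pos_divide_le_eq mult_1_left)
qed

section \<open>The bound 2 for the analytic part\<close>

lemma of_nat_minus_power_nonzero:
  fixes z :: "'a::real_normed_field"
  assumes "m \<ge> 1" "norm z < 1"
  shows "of_nat m - z ^ m \<noteq> 0"
proof
  assume "of_nat m - z ^ m = 0"
  then have "norm (z ^ m) = real m" by (metis eq_iff_diff_eq_0 norm_of_nat)
  moreover have "norm (z ^ m) < 1"
    using assms by (simp add: norm_power power_less_one_iff)
  ultimately show False using assms(1) by simp
qed

text \<open>For m = 1 the factor 1 - r of 1 - r^2 appears on both sides, and 1 + r \<le> 2 remains.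
  For m \<ge> 2 crude bounds suffice: the left side is at most m, and the right side is at least 2m
  - 2 \<ge> m.\<close>

lemma one_minus_square_mult_le:
  fixes r :: real
  assumes m: "m \<ge> 1" and r: "0 \<le> r" "r < 1"
  shows "(1 - r\<^sup>2) * (real m * r ^ (m - 1)) \<le> 2 * (real m - r ^ m)"
proof (cases "m = 1")
  case True
  have "1 - r\<^sup>2 = (1 + r) * (1 - r)" by (simp add: algebra_simps power2_eq_square)
  also have "\<dots> \<le> 2 * (1 - r)" using r by (intro mult_right_mono) auto
  finally show ?thesis using True by simp
next
  case False
  have "r ^ m \<le> 1" "r ^ (m - 1) \<le> 1" "1 - r\<^sup>2 \<le> 1" "1 - r\<^sup>2 \<ge> 0"
    using r by (auto intro: power_le_one)
  then have "(1 - r\<^sup>2) * (real m * r ^ (m - 1)) \<le> 1 * (real m * 1)"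
    using r by (intro mult_mono mult_nonneg_nonneg) auto
  also have "\<dots> \<le> 2 * (real m - r ^ m)"
  proof -
    have "real m \<ge> 2" using False m by simp
    then show ?thesis using \<open>r ^ m \<le> 1\<close> by simp
  qed
  finally show ?thesis .
qed

lemma class_R_deriv2_over_deriv:
  assumes m: "m \<ge> 1" and h: "\<forall>z\<in>unit_disc. deriv h z = of_nat m / (of_nat m - z ^ m)"
    and z: "z \<in> unit_disc"
  shows "deriv (deriv h) z / deriv h z = of_nat m * z ^ (m - 1) / (of_nat m - z ^ m)"
proof -
  have nz: "of_nat m - z ^ m \<noteq> 0"
    using of_nat_minus_power_nonzero[OF m] z by (simp add: unit_disc_def)
  have "((\<lambda>w. of_nat m / (of_nat m - w ^ m)) has_field_derivative
      of_nat m * (of_nat m * z ^ (m - 1)) / (of_nat m - z ^ m)\<^sup>2) (at z)"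
    using nz by (auto intro!: derivative_eq_intros simp: power2_eq_square)
  then have "(deriv h has_field_derivative
      of_nat m * (of_nat m * z ^ (m - 1)) / (of_nat m - z ^ m)\<^sup>2) (at z)"
    by (rule has_field_derivative_transform_within_open[of _ _ _ unit_disc])
      (use z h in \<open>auto simp: unit_disc_def\<close>)
  then have "deriv (deriv h) z = of_nat m * (of_nat m * z ^ (m - 1)) / (of_nat m - z ^ m)\<^sup>2"
    by (rule DERIV_imp_deriv)
  then show ?thesis using bspec[OF h z] nz m by (simp add: power2_eq_square)
qed

text \<open>On the circle |z| = r the numerator of h''/h' has constant modulus, and the reverse
  triangle inequality gives |m - z^m| \<ge> m - r^m. This reduces the claim to the real inequality
  \<open>one_minus_square_mult_le\<close>.\<close>

lemma class_R_pre_schwarzian_le: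
  assumes "h \<in> class_R" and z: "z \<in> unit_disc"
  shows "(1 - (norm z)\<^sup>2) * norm (deriv (deriv h) z / deriv h z) \<le> 2"
proof -
  obtain m :: nat where m: "m \<ge> 1"
    and h: "\<forall>z\<in>unit_disc. deriv h z = of_nat m / (of_nat m - z ^ m)"
    using assms(1) by (auto simp: class_R_def)
  define r where "r = norm z"
  have r: "0 \<le> r" "r < 1" using z by (auto simp: r_def unit_disc_def)
  have pos: "real m - r ^ m > 0"
    using m r power_less_one_iff[of r m] by simp
  have "real m - r ^ m \<le> norm (of_nat m - z ^ m)"
    using norm_triangle_ineq2[of "of_nat m" "z ^ m"] by (simp add: r_def norm_power)
  then have "real m * r ^ (m - 1) / norm (of_nat m - z ^ m) \<le> real m * r ^ (m - 1) / (real m - r ^ m)"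
    using pos r by (intro frac_le) auto
  then have "norm (deriv (deriv h) z / deriv h z) \<le> real m * r ^ (m - 1) / (real m - r ^ m)"
    unfolding class_R_deriv2_over_deriv[OF m h z] by (simp add: norm_divide norm_mult norm_power r_def)
  then have "(1 - r\<^sup>2) * norm (deriv (deriv h) z / deriv h z)
      \<le> (1 - r\<^sup>2) * (real m * r ^ (m - 1) / (real m - r ^ m))"
    using r by (intro mult_left_mono) (auto intro: power_le_one)
  also have "\<dots> \<le> 2"
    using one_minus_square_mult_le[OF m r] pos by (simp add: field_simps)
  finally show ?thesis by (simp add: r_def)
qed

section \<open>The dilatation and the upper bound 3\<close>

lemma harmonic_rep_dilatation:
  assumes rep: "harmonic_rep f h g" and pos: "\<forall>z\<in>unit_disc. jacobian_det f z > 0"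
  shows "dilatation h g holomorphic_on ball 0 1"
    and "\<And>z. norm z < 1 \<Longrightarrow> norm (dilatation h g z) < 1"
proof -
  have less: "norm (deriv g z) < norm (deriv h z)" if "norm z < 1" for z
  proof -
    have z: "z \<in> unit_disc" using that by (simp add: unit_disc_def)
    then have "(norm (deriv g z))\<^sup>2 < (norm (deriv h z))\<^sup>2"
      using pos jacobian_det_eq[OF rep z] by fastforce
    then show ?thesis by (rule power_less_imp_less_base) simp
  qed
  \<comment> \<open>The inequality is strict, so \<open>deriv h\<close> has no zero in the disc;
    this makes the quotient holomorphic.\<close>
  then have nz: "deriv h z \<noteq> 0" if "norm z < 1" for z
    using that by fastforce
  show "norm (dilatation h g z) < 1" if "norm z < 1" for z
    using less[OF that] nz[OF that] by (simp add: dilatation_def norm_divide)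
  have "(\<lambda>z. deriv g z / deriv h z) holomorphic_on ball 0 1"
    using rep nz
    by (auto simp: harmonic_rep_def class_A_def unit_disc_def intro!: holomorphic_intros)
  then show "dilatation h g holomorphic_on ball 0 1"
    by (simp add: dilatation_def[abs_def])
qed

lemma class_HR_pre_schwarzian_norm_le:
  assumes "f \<in> class_HR"
  shows "pre_schwarzian_norm f \<le> 3"
  unfolding pre_schwarzian_norm_def
proof (rule SUP_least)
  fix z assume z: "z \<in> unit_disc"
  \<comment> \<open>Positivity of the Jacobian is a property of \<open>f\<close> alone, so it may be
    combined with the representation whose \<open>h\<close> lies in \<open>class_R\<close>.\<close>
  obtain h g where rep: "harmonic_rep f h g" and hR: "h \<in> class_R"
    and pos: "\<forall>z\<in>unit_disc. jacobian_det f z > 0"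
    using assms by (auto simp: class_HR_def class_H_def)
  define \<omega> where "\<omega> = dilatation h g"
  note dil = harmonic_rep_dilatation[OF rep pos, folded \<omega>_def]
  have z1: "norm z < 1" using z by (simp add: unit_disc_def)
  then have w1: "norm (\<omega> z) < 1" using dil(2) by simp
  then have w2: "1 - (norm (\<omega> z))\<^sup>2 > 0" by (simp add: abs_square_less_1)
  have z2: "1 - (norm z)\<^sup>2 \<ge> 0" using z1 by (simp add: power_le_one)
  define A where "A = deriv (deriv h) z / deriv h z"
  define B where "B = cnj (\<omega> z) * deriv \<omega> z / complex_of_real (1 - (norm (\<omega> z))\<^sup>2)"
  have "norm B = norm (\<omega> z) * norm (deriv \<omega> z) / (1 - (norm (\<omega> z))\<^sup>2)"
    using w2 by (simp add: B_def norm_mult norm_divide del: of_real_diff)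
  \<comment> \<open>Regrouping isolates the Schwarz-Pick quotient, which is at most 1; the other
    factor is |\<omega> z| < 1.\<close>
  then have "(1 - (norm z)\<^sup>2) * norm B
      = norm (\<omega> z) * ((1 - (norm z)\<^sup>2) * norm (deriv \<omega> z) / (1 - (norm (\<omega> z))\<^sup>2))"
    by simp
  also have "\<dots> \<le> 1 * 1"
    using Schwarz_Pick_deriv[OF dil z1] w1 w2 z2
    by (intro mult_mono) (auto intro!: divide_nonneg_pos mult_nonneg_nonneg)
  finally have "(1 - (norm z)\<^sup>2) * norm B \<le> 1" by simp
  moreover have "(1 - (norm z)\<^sup>2) * norm A \<le> 2"
    unfolding A_def using class_R_pre_schwarzian_le[OF hR z] .
  moreover have "(1 - (norm z)\<^sup>2) * norm (A - B) \<le> (1 - (norm z)\<^sup>2) * (norm A + norm B)"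
    by (rule mult_left_mono[OF norm_triangle_ineq4 z2])
  moreover have "pre_schwarzian f z = A - B"
    unfolding A_def B_def \<omega>_def by (rule pre_schwarzian_eq[OF rep pos z])
  ultimately show "ereal ((1 - (norm z)\<^sup>2) * norm (pre_schwarzian f z)) \<le> 3"
    by (simp add: distrib_left)
qed

section \<open>Construction of functions with prescribed dilatation, and sharpness\<close>

lemma unit_disc_primitive:
  assumes "F holomorphic_on unit_disc"
  obtains G where "G holomorphic_on unit_disc" "G 0 = 0" "\<And>z. z \<in> unit_disc \<Longrightarrow> deriv G z = F z"
proof -
  obtain G where G: "\<And>z. z \<in> unit_disc \<Longrightarrow> (G has_field_derivative F z) (at z within unit_disc)"
    using holomorphic_convex_primitive'[of unit_disc F] assms by (auto simp: unit_disc_def)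
  \<comment> \<open>A primitive exists because the disc is convex; subtracting \<open>G 0\<close>
    gives the normalisation that \<open>class_A\<close> and \<open>harmonic_rep\<close>
    demand.\<close>
  have G': "((\<lambda>z. G z - G 0) has_field_derivative F z) (at z)" if "z \<in> unit_disc" for z
    using G[OF that] that at_within_open[of z unit_disc]
    by (auto intro!: derivative_eq_intros simp: unit_disc_def)
  show thesis
  proof (rule that)
    show "(\<lambda>z. G z - G 0) holomorphic_on unit_disc"
      using G' unfolding unit_disc_def holomorphic_on_open[OF open_ball] by blast
    show "deriv (\<lambda>z. G z - G 0) z = F z" if "z \<in> unit_disc" for z
      using G'[OF that] by (rule DERIV_imp_deriv)
  qed simp
qed

text \<open>Both h' = m / (m - z^m) and g' = \<omega> h' are integrated from 0. Since h' has no zero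
  and |\<omega>| < 1, the Jacobian |h'|^2 (1 - |\<omega>|^2) is positive.\<close>

lemma harmonic_with_dilatation_exists:
  assumes m: "m \<ge> 1" and hol: "\<omega> holomorphic_on unit_disc"
    and less1: "\<And>z. z \<in> unit_disc \<Longrightarrow> norm (\<omega> z) < 1"
  obtains f h g where "f \<in> class_HR" "harmonic_rep f h g"
    "\<forall>z\<in>unit_disc. jacobian_det f z > 0"
    "\<forall>z\<in>unit_disc. deriv h z = of_nat m / (of_nat m - z ^ m)"
    "\<forall>z\<in>unit_disc. dilatation h g z = \<omega> z"
proof -
  have nz: "of_nat m - z ^ m \<noteq> 0" if "z \<in> unit_disc" for z :: complex
    using of_nat_minus_power_nonzero[OF m] that by (simp add: unit_disc_def)
  have hol_h': "(\<lambda>z. of_nat m / (of_nat m - z ^ m)) holomorphic_on unit_disc"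
    using nz by (intro holomorphic_intros) auto
  obtain h where h: "h holomorphic_on unit_disc" "h 0 = 0"
    and h': "\<And>z. z \<in> unit_disc \<Longrightarrow> deriv h z = of_nat m / (of_nat m - z ^ m)"
    using unit_disc_primitive[OF hol_h'] by metis
  obtain g where g: "g holomorphic_on unit_disc" "g 0 = 0"
    and g': "\<And>z. z \<in> unit_disc \<Longrightarrow> deriv g z = \<omega> z * (of_nat m / (of_nat m - z ^ m))"
    using unit_disc_primitive[OF holomorphic_on_mult[OF hol hol_h']] by metis
  define f where "f = (\<lambda>z. h z + cnj (g z))"
  \<comment> \<open>Here m \<ge> 1 matters: 0^m = 0, so the quotient is m / m = 1.\<close>
  have "deriv h 0 = 1" using h'[of 0] m by (simp add: unit_disc_def zero_power)
  then have hA: "h \<in> class_A" using h by (simp add: class_A_def)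
  then have rep: "harmonic_rep f h g" using g by (simp add: harmonic_rep_def f_def)
  have pos: "\<forall>z\<in>unit_disc. jacobian_det f z > 0"
  proof
    fix z assume z: "z \<in> unit_disc"
    have "norm (deriv h z) > 0" using h'[OF z] nz[OF z] m by simp
    moreover have "norm (\<omega> z) < 1" using less1[OF z] .
    moreover have "norm (deriv g z) = norm (\<omega> z) * norm (deriv h z)"
      unfolding g'[OF z] h'[OF z] by (rule norm_mult)
    ultimately have "norm (deriv g z) < norm (deriv h z)" by simp
    then show "jacobian_det f z > 0"
      using jacobian_det_eq[OF rep z] by (simp add: power_strict_mono)
  qed
  have "h \<in> class_R" using hA h' m by (auto simp: class_R_def)
  then have "f \<in> class_HR" using rep pos by (auto simp: class_HR_def class_H_def)
  moreover have "dilatation h g z = \<omega> z" if "z \<in> unit_disc" for z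
    using h'[OF that] g'[OF that] nz[OF that] m by (simp add: dilatation_def)
  ultimately show thesis using h' by (intro that[OF _ rep pos]) auto
qed

text \<open>The witness has m = 1 and dilatation \<omega>(z) = (a - z) / (1 - a z), the hyperbolic
  half-turn about r. The supremum is bounded below by the value at z = r, which is exactly 1 +
  2r.\<close>

lemma pre_schwarzian_norm_ge:
  fixes r :: real
  assumes r: "0 \<le> r" "r < 1"
  shows "\<exists>f\<in>class_HR. ereal (1 + 2 * r) \<le> pre_schwarzian_norm f"
proof -
  \<comment> \<open>This \<open>a\<close> solves (a - r) / (1 - a r) = r, so that r becomes a fixed
    point of \<omega>.\<close>
  define a where "a = 2 * r / (1 + r\<^sup>2)"
  define \<omega> where "\<omega> = (\<lambda>z. - Moebius_function 0 (of_real a) z)"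
  have p: "1 + r\<^sup>2 > 0" by (simp add: add_pos_nonneg)
  have q: "1 - r\<^sup>2 > 0" using r by (simp add: abs_square_less_1)
  have "(1 - r)\<^sup>2 > 0" using r by simp
  then have "2 * r < 1 + r\<^sup>2" by (simp add: power2_diff)
  then have a: "0 \<le> a" "a < 1" using r p by (simp_all add: a_def)
  then have na: "norm (complex_of_real a) < 1" by simp
  have nr: "norm (complex_of_real r) < 1" using r by simp
  then have z: "of_real r \<in> unit_disc" by (simp add: unit_disc_def)
  have hol: "\<omega> holomorphic_on unit_disc"
    unfolding \<omega>_def unit_disc_def by (intro holomorphic_intros Moebius_function_holomorphic na)
  have less1: "norm (\<omega> z) < 1" if "z \<in> unit_disc" for z
    using that Moebius_function_norm_lt_1[OF na] by (simp add: \<omega>_def unit_disc_def)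
  obtain f h g where fHR: "f \<in> class_HR" and rep: "harmonic_rep f h g"
    and pos: "\<forall>z\<in>unit_disc. jacobian_det f z > 0"
    and h': "\<forall>z\<in>unit_disc. deriv h z = of_nat 1 / (of_nat 1 - z ^ 1)"
    and dil: "\<forall>z\<in>unit_disc. dilatation h g z = \<omega> z"
    by (rule harmonic_with_dilatation_exists[OF order.refl hol less1])
  have ar: "1 - a * r = (1 - r\<^sup>2) / (1 + r\<^sup>2)" "a - r = r * (1 - r\<^sup>2) / (1 + r\<^sup>2)"
    using p by (simp_all add: a_def field_simps power2_eq_square)
  have "1 - a\<^sup>2 = ((1 + r\<^sup>2)\<^sup>2 - (2 * r)\<^sup>2) / (1 + r\<^sup>2)\<^sup>2"
    using p by (simp add: a_def power_divide diff_divide_distrib)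
  also have "(1 + r\<^sup>2)\<^sup>2 - (2 * r)\<^sup>2 = (1 - r\<^sup>2)\<^sup>2"
    by (simp add: power2_eq_square algebra_simps)
  finally have aa: "1 - a\<^sup>2 = (1 - r\<^sup>2)\<^sup>2 / (1 + r\<^sup>2)\<^sup>2" .
  have "\<omega> (of_real r) = of_real ((a - r) / (1 - a * r))"
    by (simp add: \<omega>_def Moebius_function_simple) (metis minus_diff_eq minus_divide_left)
  also have "(a - r) / (1 - a * r) = r" unfolding ar using p q by simp
  finally have w: "\<omega> (of_real r) = of_real r" .
  have "(\<omega> has_field_derivative - of_real ((1 - a\<^sup>2) / (1 - a * r)\<^sup>2)) (at (of_real r))"
    using DERIV_minus[OF Moebius_function_has_field_derivative[OF na nr]] a(1)
    by (simp add: \<omega>_def)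
  \<comment> \<open>\<omega> is a non-identity involution of the disc fixing r, so its derivative
    there has to be -1. In the computation, 1 - a^2 turns out to be the square of 1 - a r.\<close>
  also have "(1 - a\<^sup>2) / (1 - a * r)\<^sup>2 = 1"
    unfolding ar aa using p q by (simp add: power_divide)
  finally have "(\<omega> has_field_derivative - 1) (at (of_real r))" by simp
  then have "(dilatation h g has_field_derivative - 1) (at (of_real r))"
    by (rule has_field_derivative_transform_within_open[of _ _ _ unit_disc])
      (use z dil in \<open>auto simp: unit_disc_def\<close>)
  then have w': "deriv (dilatation h g) (of_real r) = - 1" by (rule DERIV_imp_deriv)
  \<comment> \<open>The derivative -1 cancels the minus sign before the dilatation term, so two
    nonnegative reals add up without loss in the triangle inequality.\<close>
  have "pre_schwarzian f (of_real r) = of_real (1 / (1 - r) + r / (1 - r\<^sup>2))"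
    unfolding pre_schwarzian_eq[OF rep pos z] class_R_deriv2_over_deriv[OF order.refl h' z]
      w' bspec[OF dil z] w
    using r by simp
  then have "(1 - (norm (complex_of_real r))\<^sup>2) * norm (pre_schwarzian f (of_real r))
      = (1 - r\<^sup>2) * (1 / (1 - r) + r / (1 - r\<^sup>2))"
    using r q by (simp del: of_real_add)
  also have "\<dots> = (1 - r\<^sup>2) / (1 - r) + r"
    using q by (simp add: distrib_left)
  also have "(1 - r\<^sup>2) / (1 - r) = 1 + r"
    using r by (simp add: field_simps power2_eq_square)
  finally have "(1 - (norm (complex_of_real r))\<^sup>2) * norm (pre_schwarzian f (of_real r)) = 1 + 2 * r"
    by simp
  then have "ereal (1 + 2 * r) \<le> pre_schwarzian_norm f"
    unfolding pre_schwarzian_norm_def using z by (intro SUP_upper2[of "of_real r"]) simp_all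
  then show ?thesis using fHR by blast
qed

theorem theorem2p1:
  shows "(\<forall>f\<in>class_HR. pre_schwarzian_norm f \<le> 3) \<and>
    \<not> (\<exists>C::real. C < 3 \<and> (\<forall>f\<in>class_HR. pre_schwarzian_norm f \<le> ereal C))"
proof (intro conjI ballI notI)
  show "pre_schwarzian_norm f \<le> 3" if "f \<in> class_HR" for f
    using that by (rule class_HR_pre_schwarzian_norm_le)
next
  assume "\<exists>C::real. C < 3 \<and> (\<forall>f\<in>class_HR. pre_schwarzian_norm f \<le> ereal C)"
  then obtain C :: real where C: "C < 3" "\<forall>f\<in>class_HR. pre_schwarzian_norm f \<le> ereal C"
    by blast
  \<comment> \<open>The bound r > (C - 1) / 2 means 1 + 2r > C, and the maximum with 0 secures the
    hypothesis 0 \<le> r of \<open>pre_schwarzian_norm_ge\<close>.\<close>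
  obtain r where r: "max 0 ((C - 1) / 2) < r" "r < 1"
    using dense[of "max 0 ((C - 1) / 2)" 1] C(1) by auto
  then obtain f where f: "f \<in> class_HR" "ereal (1 + 2 * r) \<le> pre_schwarzian_norm f"
    using pre_schwarzian_norm_ge[of r] by auto
  have "ereal (1 + 2 * r) \<le> ereal C"
    using f(2) bspec[OF C(2) f(1)] by (rule order.trans)
  then show False using r by simp
qed

end
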